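(* Let $f:\mathbb R^d\to\mathbb R$ be a standard self-concordant function, and suppose there are constants $L\ge\lambda>0$ with $\lambda I\preceq f''(w)\preceq LI$ for all $w\in\mathbb R^d$. Let $\{w_k\}_{k\ge0}$ be generated by the inexact damped Newton method (see context) from an initial point $w_0\in\mathbb R^d$ with tolerances $$\epsilon_k=\beta(\lambda/L)^{1/2}\|f'(w_k)\|_2,\qquad \beta=1/20 .$$ Let $\widetilde u_k=[f''(w_k)]^{-1/2}f'(w_k)$ and $\omega(t)=t-\log(1+t)$ for $t\ge0$. Then: (a) For any $k\ge0$, $f(w_{k+1})\le f(w_k)-\frac12\omega(\|\widetilde u_k\|_2)$. (b) If $\|\widetilde u_k\|_2\le 1/6$, then $\omega(\|\widetilde u_{k+1}\|_2)\le\frac12\omega(\|\widetilde u_k\|_2)$.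
   Context: A convex function $f:\mathbb R^d\to\mathbb R$ with continuous third derivatives is standard self-concordant if $|u^T(f'''(w)[u])u|\le 2(u^Tf''(w)u)^{3/2}$ for all $w,u\in\mathbb R^d$, where $f'''(w)[u]=\lim_{t\to0}\frac1t(f''(w+tu)-f''(w))$. Inexact damped Newton method: given $w_0$ and a nonnegative sequence $\{\epsilon_k\}$, for $k=0,1,2,\dots$: (1) find any vector $v_k$ such that $\|f''(w_k)v_k-f'(w_k)\|_2\le\epsilon_k$; (2) compute $\delta_k=\sqrt{v_k^Tf''(w_k)v_k}$ and set $w_{k+1}=w_k-\frac{1}{1+\delta_k}v_k$. *)

theory Defs
  imports "HOL-Analysis.Analysis"
begin

definition gradient :: "(real ^ 'n \<Rightarrow> real) \<Rightarrow> real ^ 'n \<Rightarrow> real ^ 'n" where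
  "gradient f w = (THE D. GDERIV f w :> D)"

definition hessian :: "(real ^ 'n \<Rightarrow> real) \<Rightarrow> real ^ 'n \<Rightarrow> real ^ 'n ^ 'n" where
  "hessian f w = jacobian (gradient f) (at w)"

text \<open>The matrix \<open>f'''(w)[u]\<close>, the derivative of the Hessian at \<open>w\<close> in direction \<open>u\<close>.\<close>

definition third_deriv :: "(real ^ 'n \<Rightarrow> real) \<Rightarrow> real ^ 'n \<Rightarrow> real ^ 'n \<Rightarrow> real ^ 'n ^ 'n" where
  "third_deriv f w u =
     Lim (at 0) (\<lambda>t::real. (1 / t) *\<^sub>R (hessian f (w + t *\<^sub>R u) - hessian f w))"

text \<open>
  The differentiability clauses make \<open>gradient\<close>, \<open>hessian\<close> and \<open>third_deriv\<close> well defined. In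
  finite dimension, continuity of the third derivative is continuity in \<open>w\<close> for each direction \<open>u\<close>.
\<close>

definition continuous_third_derivs :: "(real ^ 'n \<Rightarrow> real) \<Rightarrow> bool" where
  "continuous_third_derivs f \<longleftrightarrow>
     (\<forall>w. f differentiable at w) \<and>
     (\<forall>w. gradient f differentiable at w) \<and>
     (\<forall>w. hessian f differentiable at w) \<and>
     (\<forall>u. continuous_on UNIV (\<lambda>w. third_deriv f w u))"

definition standard_self_concordant :: "(real ^ 'n \<Rightarrow> real) \<Rightarrow> bool" where
  "standard_self_concordant f \<longleftrightarrow>
     convex_on UNIV f \<and> continuous_third_derivs f \<and>
     (\<forall>w u. \<bar>u \<bullet> (third_deriv f w u *v u)\<bar> \<le> 2 * (u \<bullet> (hessian f w *v u)) powr (3 / 2))"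

definition pos_semidef :: "real ^ 'n ^ 'n \<Rightarrow> bool" where
  "pos_semidef A \<longleftrightarrow> transpose A = A \<and> (\<forall>x. 0 \<le> x \<bullet> (A *v x))"

definition loewner_le :: "real ^ 'n ^ 'n \<Rightarrow> real ^ 'n ^ 'n \<Rightarrow> bool"  (infix \<open>\<preceq>\<close> 50) where
  "A \<preceq> B \<longleftrightarrow> pos_semidef (B - A)"

text \<open>The positive semidefinite square root (meaningful for positive semidefinite arguments).\<close>

definition matrix_sqrt :: "real ^ 'n ^ 'n \<Rightarrow> real ^ 'n ^ 'n" where
  "matrix_sqrt A = (THE S. pos_semidef S \<and> S ** S = A)"

definition matrix_inv_sqrt :: "real ^ 'n ^ 'n \<Rightarrow> real ^ 'n ^ 'n" where
  "matrix_inv_sqrt A = matrix_inv (matrix_sqrt A)"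

text \<open>
  The sequence \<open>w\<close> is a run of the inexact damped Newton method with tolerances \<open>\<epsilon>\<close>; the step
  vectors \<open>v\<close> are arbitrary subject to the residual bound.
\<close>

definition inexact_damped_newton ::
    "(real ^ 'n \<Rightarrow> real) \<Rightarrow> (nat \<Rightarrow> real) \<Rightarrow> (nat \<Rightarrow> real ^ 'n) \<Rightarrow> bool" where
  "inexact_damped_newton f \<epsilon> w \<longleftrightarrow>
     (\<forall>k. 0 \<le> \<epsilon> k) \<and>
     (\<forall>k. \<exists>v. norm (hessian f (w k) *v v - gradient f (w k)) \<le> \<epsilon> k \<and>
        (let \<delta> = sqrt (v \<bullet> (hessian f (w k) *v v))
         in w (Suc k) = w k - (1 / (1 + \<delta>)) *\<^sub>R v))"

definition omega :: "real \<Rightarrow> real" where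
  "omega t = t - ln (1 + t)"

end

theory Submission
  imports Defs
begin

text \<open>
  Let \<open>S\<close> be the square root of the Hessian at \<open>w\<^sub>k\<close> and \<open>v\<close> the computed step. The tolerance makes
  \<open>|u\<^sub>k - S v| \<le> \<beta> |u\<^sub>k|\<close>, and the logarithmic upper bound for self-concordant functions then shows
  that one step decreases \<open>f\<close> by at least \<open>0.8 \<omega>(|u\<^sub>k|)\<close>, which gives (a).

  For (b), an exact damped step from \<open>w\<^sub>k\<^sub>+\<^sub>1\<close> decreases \<open>f\<close> by a further \<open>\<omega>(|u\<^sub>k\<^sub>+\<^sub>1|)\<close>. Since \<open>f\<close> never
  drops below \<open>f(w\<^sub>k) - \<omega>\<^sup>*(|u\<^sub>k|)\<close>, where \<open>\<omega>\<^sup>*(t) = - t - ln (1 - t)\<close> is at most \<open>1.3 \<omega>(t)\<close> for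
  \<open>t \<le> 1/6\<close>, the two decreases sum to at most \<open>1.3 \<omega>(|u\<^sub>k|)\<close>.
\<close>

section \<open>Positive semidefinite square roots\<close>

lemma symmetric_inner_matrix:
  fixes A :: "real ^ 'n ^ 'n"
  assumes "transpose A = A"
  shows "(A *v x) \<bullet> y = x \<bullet> (A *v y)"
  by (metis assms dot_lmul_matrix transpose_matrix_vector)

lemma transpose_add: "transpose (A + B) = transpose A + transpose B"
  and transpose_diff: "transpose (A - B) = transpose A - transpose B"
  for A B :: "real ^ 'n ^ 'm"
  by (auto simp: transpose_def vec_eq_iff)

lemma matrix_vector_mat: "mat c *v x = c *\<^sub>R x" for x :: "real ^ 'n"
  by (simp add: matrix_vector_mult_def mat_def vec_eq_iff if_distrib[of "\<lambda>c. c * _"] cong: if_cong)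

text \<open>Positivity of \<open>B\<close> at \<open>x - B *v x\<close>, expanded by symmetry, gives
  the bound once both remaining forms are estimated by the second hypothesis.\<close>

lemma pos_semidef_contraction:
  assumes "pos_semidef B" and "\<And>x. x \<bullet> (B *v x) \<le> x \<bullet> x"
  shows "norm (B *v x) \<le> norm x"
proof -
  have sym: "(B *v x) \<bullet> y = x \<bullet> (B *v y)" for x y
    using assms(1) by (simp add: pos_semidef_def symmetric_inner_matrix)
  have "0 \<le> (x - B *v x) \<bullet> (B *v (x - B *v x))"
    using assms(1) by (simp add: pos_semidef_def)
  also have "\<dots> = x \<bullet> (B *v x) - 2 * ((B *v x) \<bullet> (B *v x)) + (B *v x) \<bullet> (B *v (B *v x))"
    by (simp add: algebra_simps inner_diff_left inner_diff_right sym)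
  also have "\<dots> \<le> x \<bullet> x - (B *v x) \<bullet> (B *v x)"
    using assms(2)[of x] assms(2)[of "B *v x"] by linarith
  finally show ?thesis by (simp add: norm_le)
qed

text \<open>If \<open>y = S *v x\<close> were nonzero, moving from \<open>x\<close> a little in
  direction \<open>- y\<close> would make the quadratic form negative: the linear term is
  \<open>- 2 * t * (y \<bullet> y)\<close> and the rest is of order
  \<open>t\<^sup>2\<close>.\<close>

lemma pos_semidef_kernel:
  assumes S: "pos_semidef S" and x: "x \<bullet> (S *v x) = 0"
  shows "S *v x = 0"
proof (rule ccontr)
  assume ne: "S *v x \<noteq> 0"
  define y where "y = S *v x"
  define a where "a = y \<bullet> y"
  define b where "b = y \<bullet> (S *v y)"
  have sym: "x \<bullet> (S *v y) = y \<bullet> y"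
    using S by (metis pos_semidef_def symmetric_inner_matrix y_def)
  have a: "a > 0" and b: "b \<ge> 0"
    using ne S by (auto simp: a_def b_def y_def pos_semidef_def)
  \<comment> \<open>This \<open>t\<close> is small enough that \<open>t * b \<le> a\<close>, so the
    linear term dominates; the \<open>+ 1\<close> covers \<open>b = 0\<close>.\<close>
  define t where "t = a / (b + 1)"
  have "0 \<le> (x - t *\<^sub>R y) \<bullet> (S *v (x - t *\<^sub>R y))"
    using S by (simp add: pos_semidef_def)
  also have "\<dots> = t * (t * b - 2 * a)"
    using x sym unfolding a_def b_def
    by (simp add: algebra_simps inner_diff_left inner_diff_right flip: y_def)
  finally have "0 \<le> t * (t * b - 2 * a)" .
  moreover have "t > 0" using a b by (simp add: t_def)
  moreover have "t * b \<le> a" using a b by (simp add: t_def field_simps)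
  ultimately show False using a by (simp add: zero_le_mult_iff)
qed

lemma pos_semidef_square_inner:
  assumes "pos_semidef S" and "S ** S = A"
  shows "(S *v x) \<bullet> (S *v y) = x \<bullet> (A *v y)"
  using assms by (metis matrix_vector_mul_assoc pos_semidef_def symmetric_inner_matrix)

text \<open>With \<open>D = S - T\<close> one has
  \<open>D ** S + T ** D = S ** S - T ** T = 0\<close>. Multiplying by \<open>D\<close> on the right
  and taking traces gives tr(DSD) + tr(DTD) = 0 with both terms nonnegative, hence
  \<open>S *v (D *v b) = 0\<close> on the basis, and positive definiteness of \<open>A\<close>
  forces \<open>D *v b = 0\<close>.\<close>

lemma pos_semidef_root_unique:
  fixes S T A :: "real ^ 'n ^ 'n"
  assumes S: "pos_semidef S" "S ** S = A" and T: "pos_semidef T" "T ** T = A"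
    and pd: "\<And>x. x \<noteq> 0 \<Longrightarrow> 0 < x \<bullet> (A *v x)"
  shows "S = T"
proof -
  define D where "D = S - T"
  have sym: "transpose S = S" "transpose T = T" "transpose D = D"
    using S T by (auto simp: pos_semidef_def D_def transpose_diff)
  have "D ** S + T ** D = 0"
    using S(2) T(2) by (simp add: D_def matrix_eq algebra_simps flip: matrix_vector_mul_assoc)
  then have eq: "D *v (S *v y) + T *v (D *v y) = 0" for y
    by (metis matrix_vector_mul_assoc matrix_vector_mult_0 matrix_vector_mult_add_rdistrib)
  \<comment> \<open>Cyclicity of the trace, tr(TDD) = tr(DTD), computed by expanding inner products
    in the standard basis and exchanging the two sums.\<close>
  have tr: "(\<Sum>b\<in>Basis. b \<bullet> (T *v (D *v (D *v b)))) = (\<Sum>b\<in>Basis. (D *v b) \<bullet> (T *v (D *v b)))"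
  proof -
    have "(\<Sum>b\<in>Basis. b \<bullet> (T *v (D *v (D *v b)))) = (\<Sum>b\<in>Basis. (D *v (T *v b)) \<bullet> (D *v b))"
      by (simp add: symmetric_inner_matrix[OF sym(2)] symmetric_inner_matrix[OF sym(3)])
    also have "\<dots> = (\<Sum>b\<in>Basis. \<Sum>c\<in>Basis. ((D *v (T *v b)) \<bullet> c) * ((D *v b) \<bullet> c))"
      by (simp flip: euclidean_inner)
    also have "\<dots> = (\<Sum>b\<in>Basis. \<Sum>c\<in>Basis. (b \<bullet> (T *v (D *v c))) * (b \<bullet> (D *v c)))"
      by (simp add: symmetric_inner_matrix[OF sym(2)] symmetric_inner_matrix[OF sym(3)])
    also have "\<dots> = (\<Sum>c\<in>Basis. \<Sum>b\<in>Basis. ((T *v (D *v c)) \<bullet> b) * ((D *v c) \<bullet> b))"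
      by (subst sum.swap) (simp add: inner_commute)
    also have "\<dots> = (\<Sum>c\<in>Basis. (T *v (D *v c)) \<bullet> (D *v c))"
      by (simp flip: euclidean_inner)
    finally show ?thesis by (simp add: inner_commute)
  qed
  have "(\<Sum>b\<in>Basis. b \<bullet> (D *v (S *v (D *v b)))) + (\<Sum>b\<in>Basis. b \<bullet> (T *v (D *v (D *v b)))) = 0"
    by (simp add: eq flip: sum.distrib inner_add_right)
  then have "(\<Sum>b\<in>Basis. (D *v b) \<bullet> (S *v (D *v b))) + (\<Sum>b\<in>Basis. (D *v b) \<bullet> (T *v (D *v b))) = 0"
    by (simp only: tr) (simp add: symmetric_inner_matrix[OF sym(3)])
  moreover have "0 \<le> (\<Sum>b\<in>Basis. (D *v b) \<bullet> (S *v (D *v b)))"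
    "0 \<le> (\<Sum>b\<in>Basis. (D *v b) \<bullet> (T *v (D *v b)))"
    using S T by (auto simp: pos_semidef_def intro!: sum_nonneg)
  ultimately have "(\<Sum>b\<in>Basis. (D *v b) \<bullet> (S *v (D *v b))) = 0" by linarith
  then have "(D *v b) \<bullet> (S *v (D *v b)) = 0" if "b \<in> Basis" for b
    using S(1) that by (subst (asm) sum_nonneg_eq_0_iff) (auto simp: pos_semidef_def)
  then have "S *v (D *v b) = 0" if "b \<in> Basis" for b
    using pos_semidef_kernel[OF S(1)] that by blast
  then have "D *v b = 0" if "b \<in> Basis" for b
    using pd pos_semidef_square_inner[OF S] that by (metis inner_zero_left less_irrefl)
  then have "(*v) D = (\<lambda>x. 0)"
    by (intro linear_eq_stdbasis matrix_vector_mul_linear) (auto intro: linear_zero)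
  then have "D *v x = 0" for x by metis
  then show ?thesis by (simp add: D_def matrix_eq algebra_simps)
qed

text \<open>Writing \<open>A = I - B\<close> and \<open>S = I - Y\<close>, the equation \<open>S\<^sup>2 = A\<close> is the fixed point equation
  \<open>Y = (B + Y\<^sup>2) / 2\<close>, which Brouwer's theorem solves among the symmetric contractions.\<close>

lemma pos_semidef_root_exists:
  fixes A :: "real ^ 'n ^ 'n"
  assumes A: "pos_semidef A" and le: "\<And>x. x \<bullet> (A *v x) \<le> x \<bullet> x"
  shows "\<exists>S. pos_semidef S \<and> S ** S = A"
proof -
  define B where "B = mat 1 - A"
  have B: "pos_semidef B" "\<And>x. x \<bullet> (B *v x) \<le> x \<bullet> x"
    using A le by (auto simp: pos_semidef_def B_def transpose_diff algebra_simps inner_diff_right)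
  define K where "K = {Y :: real ^ 'n ^ 'n. transpose Y = Y \<and> (\<forall>x. norm (Y *v x) \<le> norm x)}"
  define F where "F = (\<lambda>Y :: real ^ 'n ^ 'n. (1 / 2) *\<^sub>R (B + Y ** Y))"
  have "bounded K"
  proof (rule boundedI)
    fix Y assume Y: "Y \<in> K"
    \<comment> \<open>By symmetry row \<open>i\<close> is also column \<open>i\<close>, the image of
      a unit vector under a contraction.\<close>
    have "norm (Y $ i) \<le> 1" for i
    proof -
      have "Y $ i = Y *v axis i 1"
      proof -
        have "Y $ i $ j = Y $ j $ i" for j
        proof -
          have "transpose Y $ i $ j = Y $ i $ j" using Y by (simp add: K_def)
          then show ?thesis by (simp add: transpose_def)
        qed
        then show ?thesis by (simp add: matrix_vector_mult_basis column_def vec_eq_iff)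
      qed
      moreover have "norm (Y *v axis i 1) \<le> norm (axis i (1::real) :: real ^ 'n)"
        using Y unfolding K_def by blast
      ultimately show ?thesis by (simp add: norm_axis_1)
    qed
    then have "(\<Sum>i\<in>UNIV. norm (Y $ i)) \<le> (\<Sum>i\<in>(UNIV :: 'n set). 1)"
      by (intro sum_mono)
    moreover have "norm Y \<le> (\<Sum>i\<in>UNIV. norm (Y $ i))"
      unfolding norm_vec_def by (rule L2_set_le_sum) simp
    ultimately show "norm Y \<le> real CARD('n)" by simp
  qed
  moreover have "closed K"
    unfolding K_def transpose_def matrix_vector_mult_def
    by (intro closed_Collect_conj closed_Collect_all closed_Collect_eq closed_Collect_le continuous_intros)
  ultimately have "compact K" by (simp add: compact_eq_bounded_closed)
  moreover have "convex K"
  proof (rule convexI)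
    fix X Y and a b :: real
    assume XY: "X \<in> K" "Y \<in> K" and ab: "0 \<le> a" "0 \<le> b" "a + b = 1"
    have "norm ((a *\<^sub>R X + b *\<^sub>R Y) *v x) \<le> norm x" for x
    proof -
      have "norm ((a *\<^sub>R X + b *\<^sub>R Y) *v x) \<le> a * norm (X *v x) + b * norm (Y *v x)"
        using ab norm_triangle_ineq[of "a *\<^sub>R (X *v x)" "b *\<^sub>R (Y *v x)"]
        by (simp add: matrix_vector_mult_add_rdistrib flip: scaleR_matrix_vector_assoc)
      also have "\<dots> \<le> a * norm x + b * norm x"
        using XY ab by (intro add_mono mult_left_mono) (auto simp: K_def)
      finally show ?thesis using ab by (simp flip: distrib_right)
    qed
    then show "a *\<^sub>R X + b *\<^sub>R Y \<in> K"
      using XY by (auto simp: K_def transpose_add transpose_scalar)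
  qed
  moreover have "mat 1 \<in> K" by (simp add: K_def)
  moreover have "continuous_on K F"
    unfolding F_def matrix_matrix_mult_def by (intro continuous_intros)
  moreover have "F \<in> K \<rightarrow> K"
  proof
    fix Y assume Y: "Y \<in> K"
    \<comment> \<open>\<open>F Y\<close> is the average of the contractions \<open>B\<close> and
      \<open>Y ** Y\<close>.\<close>
    have "norm (F Y *v x) \<le> norm x" for x
    proof -
      have "F Y *v x = (1 / 2) *\<^sub>R (B *v x + Y *v (Y *v x))"
        by (simp add: F_def matrix_vector_mult_add_rdistrib matrix_vector_mul_assoc
            flip: scaleR_matrix_vector_assoc)
      moreover have "norm (B *v x) \<le> norm x" by (rule pos_semidef_contraction[OF B])
      moreover have "norm (Y *v (Y *v x)) \<le> norm x"
        using Y unfolding K_def by (blast intro: order_trans)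
      ultimately show ?thesis
        using norm_triangle_ineq[of "B *v x" "Y *v (Y *v x)"] by simp
    qed
    moreover have "transpose (F Y) = F Y"
      using Y B by (simp add: F_def K_def transpose_scalar transpose_add matrix_transpose_mul pos_semidef_def)
    ultimately show "F Y \<in> K" by (simp add: K_def)
  qed
  ultimately obtain Y where Y: "Y \<in> K" "F Y = Y"
    using brouwer[of K F] by blast
  have "0 \<le> x \<bullet> ((mat 1 - Y) *v x)" for x
  proof -
    have "x \<bullet> (Y *v x) \<le> norm x * norm (Y *v x)" by (rule norm_cauchy_schwarz)
    also have "\<dots> \<le> norm x * norm x" using Y by (auto simp: K_def intro: mult_left_mono)
    finally show ?thesis by (simp add: algebra_simps inner_diff_right flip: power2_norm_eq_inner power2_eq_square)
  qed
  then have "pos_semidef (mat 1 - Y)"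
    using Y by (simp add: pos_semidef_def K_def transpose_diff)
  moreover have "(mat 1 - Y) ** (mat 1 - Y) = A"
  proof -
    have "2 *\<^sub>R Y = B + Y ** Y" by (subst Y(2)[symmetric]) (simp add: F_def)
    then have eq: "2 *\<^sub>R (Y *v x) = x - A *v x + Y *v (Y *v x)" for x
      by (metis B_def matrix_vector_mult_add_rdistrib matrix_vector_mult_diff_rdistrib
          matrix_vector_mul_assoc matrix_vector_mul_lid scaleR_matrix_vector_assoc)
    have "((mat 1 - Y) ** (mat 1 - Y)) *v x = x - 2 *\<^sub>R (Y *v x) + Y *v (Y *v x)" for x
      by (simp add: algebra_simps scaleR_2 flip: matrix_vector_mul_assoc)
    then show ?thesis by (simp add: matrix_eq eq)
  qed
  ultimately show ?thesis by blast
qed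

text \<open>Existence is obtained for \<open>A\<close> scaled by \<open>1 / L\<close>, whose form is
  at most that of the identity, and then rescaled by \<open>sqrt L\<close>. With uniqueness this
  justifies the description operator in \<open>matrix_sqrt\<close>; the lower bound makes the root
  injective, hence invertible.\<close>

lemma matrix_sqrt:
  fixes A :: "real ^ 'n ^ 'n"
  assumes A: "mat lam \<preceq> A" "A \<preceq> mat L" and lam: "0 < lam" "lam \<le> L"
  shows "pos_semidef (matrix_sqrt A)" "matrix_sqrt A ** matrix_sqrt A = A"
    "matrix_sqrt A *v (matrix_inv_sqrt A *v x) = x"
    "lam * (x \<bullet> x) \<le> x \<bullet> (A *v x)" "x \<bullet> (A *v x) \<le> L * (x \<bullet> x)"
proof -
  have lo: "lam * (x \<bullet> x) \<le> x \<bullet> (A *v x)" and up: "x \<bullet> (A *v x) \<le> L * (x \<bullet> x)" for x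
    using A by (auto simp: loewner_le_def pos_semidef_def algebra_simps inner_diff_right matrix_vector_mat)
  have "transpose (mat L - A) = mat L - A" using A by (simp add: loewner_le_def pos_semidef_def)
  then have sym: "transpose A = A" by (simp add: transpose_diff)
  have pd: "0 < x \<bullet> (A *v x)" if "x \<noteq> 0" for x
    using lo[of x] lam that by (smt (verit) inner_gt_zero_iff mult_pos_pos)
  have nonneg: "0 \<le> x \<bullet> (A *v x)" for x
    using pd[of x] by (cases "x = 0") auto
  have L: "L > 0" using lam by simp
  have "pos_semidef ((1 / L) *\<^sub>R A)"
    using sym nonneg L by (simp add: pos_semidef_def transpose_scalar flip: scaleR_matrix_vector_assoc)
  moreover have "x \<bullet> (((1 / L) *\<^sub>R A) *v x) \<le> x \<bullet> x" for x
    using up[of x] L by (simp add: field_simps flip: scaleR_matrix_vector_assoc)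
  ultimately obtain S where S: "pos_semidef S" "S ** S = (1 / L) *\<^sub>R A"
    using pos_semidef_root_exists by blast
  have "pos_semidef (sqrt L *\<^sub>R S)"
    using S(1) L by (simp add: pos_semidef_def transpose_scalar flip: scaleR_matrix_vector_assoc)
  moreover have "(sqrt L *\<^sub>R S) ** (sqrt L *\<^sub>R S) = A"
    using S(2) L by (simp add: matrix_scalar_ac scalar_matrix_assoc[symmetric])
  ultimately have "\<exists>!S. pos_semidef S \<and> S ** S = A"
    using pos_semidef_root_unique pd by blast
  from theI'[OF this] show S: "pos_semidef (matrix_sqrt A)" "matrix_sqrt A ** matrix_sqrt A = A"
    by (simp_all add: matrix_sqrt_def)
  have "matrix_sqrt A *v x = 0 \<Longrightarrow> x = 0" for x
    using pd pos_semidef_square_inner[OF S] by (metis inner_zero_left less_irrefl)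
  then have "invertible (matrix_sqrt A)"
    by (simp add: invertible_left_inverse matrix_left_invertible_ker)
  then have "matrix_sqrt A ** matrix_inv_sqrt A = mat 1"
    unfolding matrix_inv_sqrt_def matrix_inv_def invertible_def by (rule someI2_ex) simp
  then show "matrix_sqrt A *v (matrix_inv_sqrt A *v x) = x"
    by (simp add: matrix_vector_mul_assoc)
  show "lam * (x \<bullet> x) \<le> x \<bullet> (A *v x)" "x \<bullet> (A *v x) \<le> L * (x \<bullet> x)" by (fact lo up)+
qed

section \<open>Self-concordance along a line\<close>

text \<open>The vector representing the derivative \<open>f'\<close> is \<open>adjoint f' 1\<close>;
  uniqueness of derivatives makes the description in \<open>gradient\<close> well defined.\<close>

lemma GDERIV_gradient:
  assumes "f differentiable at w"
  shows "GDERIV f w :> gradient f w"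
proof -
  from assms obtain f' where f': "(f has_derivative f') (at w)"
    by (auto simp: differentiable_def)
  have "f' h = h \<bullet> adjoint f' 1" for h
    using adjoint_works[OF has_derivative_linear[OF f'], of h 1] by simp
  then have "f' = (\<lambda>h. h \<bullet> adjoint f' 1)" by blast
  with f' have "GDERIV f w :> adjoint f' 1" by (simp add: gderiv_def)
  moreover have "D = adjoint f' 1" if "GDERIV f w :> D" for D
    using that calculation has_derivative_unique[of f _ w] unfolding gderiv_def
    by (metis vector_eq_ldot)
  ultimately show ?thesis unfolding gradient_def by (metis theI)
qed

lemma has_derivative_hessian:
  assumes "gradient f differentiable at w"
  shows "(gradient f has_derivative (\<lambda>h. hessian f w *v h)) (at w)"
  using assms unfolding hessian_def by (simp add: jacobian_works)

text \<open>The chain rule along \<open>w + t *\<^sub>R u\<close> turns the Frechet derivative into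
  the limit of difference quotients that defines \<open>third_deriv\<close>.\<close>

lemma third_deriv_eq:
  assumes H: "(hessian f has_derivative H') (at w)"
  shows "third_deriv f w u = H' u"
proof -
  interpret bounded_linear H' using H by (rule has_derivative_bounded_linear)
  have "((\<lambda>t::real. w + t *\<^sub>R u) has_derivative (\<lambda>t. t *\<^sub>R u)) (at 0)"
    by (auto intro!: derivative_eq_intros)
  from has_derivative_compose[OF this, of "hessian f" H'] H
  have "((\<lambda>t. hessian f (w + t *\<^sub>R u)) has_derivative (\<lambda>t. t *\<^sub>R H' u)) (at 0)"
    by (simp add: scaleR)
  then have "((\<lambda>t. norm (hessian f (w + t *\<^sub>R u) - hessian f w - t *\<^sub>R H' u) / \<bar>t\<bar>) \<longlongrightarrow> 0) (at 0)"
    by (simp add: has_derivative_iff_norm)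
  moreover have "norm (hessian f (w + t *\<^sub>R u) - hessian f w - t *\<^sub>R H' u) / \<bar>t\<bar>
      = norm ((1 / t) *\<^sub>R (hessian f (w + t *\<^sub>R u) - hessian f w) - H' u)" if "t \<noteq> 0" for t
  proof -
    have "(1 / t) *\<^sub>R (hessian f (w + t *\<^sub>R u) - hessian f w) - H' u
      = (1 / t) *\<^sub>R (hessian f (w + t *\<^sub>R u) - hessian f w - t *\<^sub>R H' u)"
      using that by (simp add: algebra_simps)
    then show ?thesis by (simp only: norm_scaleR) simp
  qed
  ultimately have "((\<lambda>t. norm ((1 / t) *\<^sub>R (hessian f (w + t *\<^sub>R u) - hessian f w) - H' u)) \<longlongrightarrow> 0) (at 0)"
    by (simp cong: LIM_cong)
  then have "((\<lambda>t. (1 / t) *\<^sub>R (hessian f (w + t *\<^sub>R u) - hessian f w)) \<longlongrightarrow> H' u) (at 0)"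
    by (simp add: tendsto_norm_zero_iff LIM_zero_iff)
  then show ?thesis unfolding third_deriv_def by (intro tendsto_Lim) auto
qed

lemma
  assumes "continuous_third_derivs f"
  shows DERIV_line: "((\<lambda>s. f (y + s *\<^sub>R p)) has_real_derivative
      gradient f (y + s *\<^sub>R p) \<bullet> p) (at s)"
    and DERIV_line2: "((\<lambda>s. gradient f (y + s *\<^sub>R p) \<bullet> p) has_real_derivative
      p \<bullet> (hessian f (y + s *\<^sub>R p) *v p)) (at s)"
    and DERIV_line3: "((\<lambda>s. p \<bullet> (hessian f (y + s *\<^sub>R p) *v p)) has_real_derivative
      p \<bullet> (third_deriv f (y + s *\<^sub>R p) p *v p)) (at s)"
proof -
  let ?z = "y + s *\<^sub>R p"
  have line: "((\<lambda>s::real. y + s *\<^sub>R p) has_derivative (\<lambda>t. t *\<^sub>R p)) (at s)"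
    by (auto intro!: derivative_eq_intros)
  have 1: "f differentiable at ?z" "gradient f differentiable at ?z" "hessian f differentiable at ?z"
    using assms by (auto simp: continuous_third_derivs_def)
  have "(f has_derivative (\<lambda>h. h \<bullet> gradient f ?z)) (at ?z)"
    using GDERIV_gradient[OF 1(1)] by (simp add: gderiv_def)
  from has_derivative_compose[OF line this]
  show "((\<lambda>s. f (y + s *\<^sub>R p)) has_real_derivative gradient f ?z \<bullet> p) (at s)"
    by (simp add: has_field_derivative_def inner_commute mult.commute[of _ "_ \<bullet> _"] cong: if_cong)
  have "((\<lambda>s. gradient f (y + s *\<^sub>R p)) has_derivative (\<lambda>t. hessian f ?z *v (t *\<^sub>R p))) (at s)"
    by (rule has_derivative_compose[OF line has_derivative_hessian[OF 1(2)]])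
  from has_derivative_inner_left[OF this, of p]
  show "((\<lambda>s. gradient f (y + s *\<^sub>R p) \<bullet> p) has_real_derivative p \<bullet> (hessian f ?z *v p)) (at s)"
    by (simp add: has_field_derivative_def inner_commute matrix_vector_mult_scaleR mult.commute[of _ "_ \<bullet> _"])
  obtain H' where H': "(hessian f has_derivative H') (at ?z)"
    using 1(3) by (auto simp: differentiable_def)
  interpret bounded_linear H' using H' by (rule has_derivative_bounded_linear)
  have lin: "bounded_linear (\<lambda>A :: real ^ _ ^ _. p \<bullet> (A *v p))"
    by (intro linear_conv_bounded_linear[THEN iffD1] linearI)
      (auto simp: matrix_vector_mult_add_rdistrib inner_add_right simp flip: scaleR_matrix_vector_assoc)
  from bounded_linear.has_derivative[OF lin has_derivative_compose[OF line H']]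
  show "((\<lambda>s. p \<bullet> (hessian f (y + s *\<^sub>R p) *v p)) has_real_derivative
      p \<bullet> (third_deriv f ?z p *v p)) (at s)"
    by (simp add: has_field_derivative_def third_deriv_eq[OF H'] scaleR
        mult.commute[of _ "_ \<bullet> _"] flip: scaleR_matrix_vector_assoc)
qed

text \<open>The self-concordance inequality says that \<open>b powr (-1/2)\<close> is Lipschitz with constant 1.\<close>

lemma second_derivative_bounds:
  fixes b c :: "real \<Rightarrow> real"
  assumes der: "\<And>s. (b has_real_derivative c s) (at s)" and pos: "\<And>s. b s > 0"
    and c: "\<And>s. \<bar>c s\<bar> \<le> 2 * b s powr (3 / 2)" and s: "0 \<le> s"
  defines "r \<equiv> sqrt (b 0)"
  shows "b s \<ge> (r / (1 + r * s))\<^sup>2" and "r * s < 1 \<Longrightarrow> b s \<le> (r / (1 - r * s))\<^sup>2"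
proof -
  define q where "q = (\<lambda>s. b s powr (-1/2))"
  have r: "r > 0" using pos by (simp add: r_def)
  have q: "q s = 1 / sqrt (b s)" for s
    using powr_minus[of "b s" "1 / 2"] pos[of s] by (simp add: q_def powr_half_sqrt less_imp_le inverse_eq_divide)
  have dq: "(q has_real_derivative (-1/2) * b s powr (-1/2 - 1) * c s) (at s)" for s
    unfolding q_def using der[of s] pos[of s] by (auto intro!: derivative_eq_intros)
  \<comment> \<open>The powers of \<open>b s\<close> cancel exactly because self-concordance has
    exponent 3/2, and its constant 2 cancels the factor 1/2.\<close>
  have bd: "\<bar>(-1/2) * b s powr (-1/2 - 1) * c s\<bar> \<le> 1" for s
  proof -
    have "\<bar>(-1/2) * b s powr (-1/2 - 1) * c s\<bar> = (1/2) * b s powr (-3/2) * \<bar>c s\<bar>"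
      by (simp add: abs_mult)
    also have "\<dots> \<le> (1/2) * b s powr (-3/2) * (2 * b s powr (3/2))"
      by (intro mult_left_mono c) simp
    also have "\<dots> = 1" using pos[of s] by (simp flip: powr_add)
    finally show ?thesis .
  qed
  have "q 0 + 0 \<le> q s + s"
  proof (rule DERIV_nonneg_imp_nondecreasing[OF s])
    fix x show "\<exists>y. ((\<lambda>s. q s + s) has_real_derivative y) (at x) \<and> 0 \<le> y"
      using bd[of x] by (intro exI[of _ "(-1/2) * b x powr (-1/2 - 1) * c x + 1"] conjI
        DERIV_add dq DERIV_ident) linarith
  qed
  then have l: "1 / r - s \<le> 1 / sqrt (b s)" by (simp add: q r_def)
  have "q s - s \<le> q 0 - 0"
  proof (rule DERIV_nonpos_imp_nonincreasing[OF s])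
    fix x show "\<exists>y. ((\<lambda>s. q s - s) has_real_derivative y) (at x) \<and> y \<le> 0"
      using bd[of x] by (intro exI[of _ "(-1/2) * b x powr (-1/2 - 1) * c x - 1"] conjI
        DERIV_diff dq DERIV_ident) linarith
  qed
  then have u: "1 / sqrt (b s) \<le> 1 / r + s" by (simp add: q r_def)
  have sb: "sqrt (b s) > 0" using pos by simp
  have "r / (1 + r * s) \<le> sqrt (b s)"
    using u r s sb by (simp add: field_simps add_pos_nonneg)
  then have "(r / (1 + r * s))\<^sup>2 \<le> (sqrt (b s))\<^sup>2"
    using r s by (intro power_mono) auto
  then show "b s \<ge> (r / (1 + r * s))\<^sup>2" using pos[of s] by simp
  assume rs: "r * s < 1"
  \<comment> \<open>Taking reciprocals in \<open>l\<close> needs \<open>1 / r - s\<close> to be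
    positive, which is \<open>r * s < 1\<close>.\<close>
  have "sqrt (b s) \<le> r / (1 - r * s)"
    using l r s sb rs by (simp add: field_simps)
  then have "(sqrt (b s))\<^sup>2 \<le> (r / (1 - r * s))\<^sup>2"
    using sb by (intro power_mono) auto
  then show "b s \<le> (r / (1 - r * s))\<^sup>2" using pos[of s] by simp
qed

text \<open>The bounds on the second derivative are integrated twice from 0 to 1, each integration
  being phrased as monotonicity of a difference. An antiderivative of
  \<open>(r / (1 + r * s))\<^sup>2\<close> is \<open>- r / (1 + r * s)\<close>, and the next
  integration produces the logarithm; the upper bound is the same with
  \<open>1 - r * s\<close>.\<close>

lemma
  fixes a b c g :: "real \<Rightarrow> real"
  assumes dg: "\<And>s. (g has_real_derivative a s) (at s)"
    and da: "\<And>s. (a has_real_derivative b s) (at s)"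
    and db: "\<And>s. (b has_real_derivative c s) (at s)" and pos: "\<And>s. b s > 0"
    and c: "\<And>s. \<bar>c s\<bar> \<le> 2 * b s powr (3 / 2)"
  defines "r \<equiv> sqrt (b 0)"
  shows self_concordant_line_ge: "g 1 \<ge> g 0 + a 0 + r - ln (1 + r)"
    and self_concordant_line_le: "r < 1 \<Longrightarrow> g 1 \<le> g 0 + a 0 - r - ln (1 - r)"
proof -
  have r: "r > 0" using pos by (simp add: r_def)
  have p: "1 + r * s > 0" if "0 \<le> s" for s using r that by (simp add: add_pos_nonneg)
  have a: "a 0 + r - r / (1 + r * s) \<le> a s" if s: "0 \<le> s" for s
  proof -
    have "a 0 + r / (1 + r * 0) \<le> a s + r / (1 + r * s)"
    proof (rule DERIV_nonneg_imp_nondecreasing[OF s])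
      fix x assume x: "0 \<le> x" "x \<le> s"
      have "((\<lambda>s. a s + r / (1 + r * s)) has_real_derivative b x - (r / (1 + r * x))\<^sup>2) (at x)"
        using p[OF x(1)]
        by (auto intro!: derivative_eq_intros da simp: field_simps power2_eq_square)
      then show "\<exists>y. ((\<lambda>s. a s + r / (1 + r * s)) has_real_derivative y) (at x) \<and> 0 \<le> y"
        using second_derivative_bounds(1)[OF db pos c x(1)] unfolding r_def
        by (intro exI conjI) (assumption, simp)
    qed
    then show ?thesis by simp
  qed
  have "g 0 - (a 0 + r) * 0 + ln (1 + r * 0) \<le> g 1 - (a 0 + r) * 1 + ln (1 + r * 1)"
  proof (rule DERIV_nonneg_imp_nondecreasing[where f = "\<lambda>s. g s - (a 0 + r) * s + ln (1 + r * s)"])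
    fix x :: real assume x: "0 \<le> x" "x \<le> 1"
    have "((\<lambda>s. g s - (a 0 + r) * s + ln (1 + r * s)) has_real_derivative
        a x - (a 0 + r) + r / (1 + r * x)) (at x)"
      using p[OF x(1)] by (auto intro!: derivative_eq_intros dg simp: field_simps)
    then show "\<exists>y. ((\<lambda>s. g s - (a 0 + r) * s + ln (1 + r * s)) has_real_derivative y) (at x) \<and> 0 \<le> y"
      using a[OF x(1)] by (intro exI conjI) (assumption, simp)
  qed simp
  then show "g 1 \<ge> g 0 + a 0 + r - ln (1 + r)" by simp
  assume r1: "r < 1"
  have m: "r * s < 1" if "0 \<le> s" "s \<le> 1" for s
    using r r1 that mult_left_mono[of s 1 r] by linarith
  have a: "a s \<le> a 0 - r + r / (1 - r * s)" if s: "0 \<le> s" "s \<le> 1" for s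
  proof -
    have "r / (1 - r * 0) - a 0 \<le> r / (1 - r * s) - a s"
    proof (rule DERIV_nonneg_imp_nondecreasing[OF s(1)])
      fix x assume x: "0 \<le> x" "x \<le> s"
      then have rx: "r * x < 1" using m s by simp
      have "((\<lambda>s. r / (1 - r * s) - a s) has_real_derivative (r / (1 - r * x))\<^sup>2 - b x) (at x)"
        using rx
        by (auto intro!: derivative_eq_intros da simp: field_simps power2_eq_square)
      then show "\<exists>y. ((\<lambda>s. r / (1 - r * s) - a s) has_real_derivative y) (at x) \<and> 0 \<le> y"
        using second_derivative_bounds(2)[OF db pos c x(1)] rx unfolding r_def
        by (intro exI conjI) (assumption, simp)
    qed
    then show ?thesis by simp
  qed
  have "(a 0 - r) * 0 - g 0 - ln (1 - r * 0) \<le> (a 0 - r) * 1 - g 1 - ln (1 - r * 1)"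
  proof (rule DERIV_nonneg_imp_nondecreasing[where f = "\<lambda>s. (a 0 - r) * s - g s - ln (1 - r * s)"])
    fix x :: real assume x: "0 \<le> x" "x \<le> 1"
    have "((\<lambda>s. (a 0 - r) * s - g s - ln (1 - r * s)) has_real_derivative
        (a 0 - r) - a x + r / (1 - r * x)) (at x)"
      using m[OF x] by (auto intro!: derivative_eq_intros dg simp: field_simps)
    then show "\<exists>y. ((\<lambda>s. (a 0 - r) * s - g s - ln (1 - r * s)) has_real_derivative y) (at x) \<and> 0 \<le> y"
      using a[OF x] by (intro exI conjI) (assumption, simp)
  qed simp
  then show "g 1 \<le> g 0 + a 0 - r - ln (1 - r)" by simp
qed

section \<open>Scalar inequalities for \<open>omega\<close> and its conjugate\<close>

lemma nonneg_if_deriv_nonneg: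
  fixes h h' :: "real \<Rightarrow> real"
  assumes "0 \<le> t" "h 0 = 0" "\<And>x. 0 \<le> x \<Longrightarrow> x \<le> t \<Longrightarrow> (h has_real_derivative h' x) (at x)"
    "\<And>x. 0 \<le> x \<Longrightarrow> x \<le> t \<Longrightarrow> 0 \<le> h' x"
  shows "0 \<le> h t"
  using DERIV_nonneg_imp_nondecreasing[of 0 t h] assms by fastforce

lemma omega_mono:
  assumes "0 \<le> s" "s \<le> t" shows "omega s \<le> omega t"
  unfolding omega_def
proof (rule DERIV_nonneg_imp_nondecreasing[OF assms(2)])
  fix x assume "s \<le> x" "x \<le> t"
  then have "((\<lambda>t. t - ln (1 + t)) has_real_derivative x / (1 + x)) (at x)" "0 \<le> x / (1 + x)"
    using assms by (auto intro!: derivative_eq_intros simp: field_simps)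
  then show "\<exists>y. ((\<lambda>t. t - ln (1 + t)) has_real_derivative y) (at x) \<and> 0 \<le> y" by blast
qed

text \<open>The difference vanishes at 0 and has a nonnegative derivative. This bound later absorbs
  the error of an inexact step into \<open>omega\<close>.\<close>

lemma omega_ge:
  assumes t: "0 \<le> t" shows "t\<^sup>2 / (2 * (1 + t)) \<le> omega t"
proof -
  have "0 \<le> t - ln (1 + t) - t\<^sup>2 / (2 * (1 + t))"
  proof (rule nonneg_if_deriv_nonneg[OF t, where h' = "\<lambda>x. x\<^sup>2 / (2 * (1 + x)\<^sup>2)"])
    fix x :: real assume "0 \<le> x"
    then show "((\<lambda>t. t - ln (1 + t) - t\<^sup>2 / (2 * (1 + t))) has_real_derivative x\<^sup>2 / (2 * (1 + x)\<^sup>2)) (at x)"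
      by (auto intro!: derivative_eq_intros) (simp add: divide_simps, simp add: algebra_simps power2_eq_square)
  qed auto
  then show ?thesis by (simp add: omega_def)
qed

lemma omega_nonneg: "0 \<le> t \<Longrightarrow> 0 \<le> omega t"
  using omega_mono[of 0 t] by (simp add: omega_def)

text \<open>After differentiating in \<open>t\<close>, both sides carry the factor
  \<open>c\<^sup>2 * x\<close>, and only the denominators \<open>1 + c * x\<close> and
  \<open>1 + x\<close> differ.\<close>

lemma omega_scale_ge:
  assumes c: "0 \<le> c" "c \<le> 1" and t: "0 \<le> t"
  shows "c\<^sup>2 * omega t \<le> omega (c * t)"
proof -
  have "0 \<le> (c * t - ln (1 + c * t)) - c\<^sup>2 * (t - ln (1 + t))"
  proof (rule nonneg_if_deriv_nonneg[OF t, where h' = "\<lambda>x. c\<^sup>2 * (x / (1 + c * x) - x / (1 + x))"])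
    fix x :: real assume x: "0 \<le> x"
    then have p: "1 + c * x > 0" using c by (simp add: add_pos_nonneg)
    then show "((\<lambda>t. (c * t - ln (1 + c * t)) - c\<^sup>2 * (t - ln (1 + t))) has_real_derivative
        c\<^sup>2 * (x / (1 + c * x) - x / (1 + x))) (at x)"
      using x by (auto intro!: derivative_eq_intros simp: divide_simps) (simp add: algebra_simps power2_eq_square)
    have "x / (1 + x) \<le> x / (1 + c * x)"
      using x p c by (intro divide_left_mono) (auto simp: mult_left_le_one_le)
    then show "0 \<le> c\<^sup>2 * (x / (1 + c * x) - x / (1 + x))" by simp
  qed auto
  then show ?thesis by (simp add: omega_def)
qed

text \<open>The function \<open>- t - ln (1 - t)\<close> is the convex conjugate of \<open>omega\<close>.\<close>

lemma omega_conjugate_le: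
  assumes t: "0 \<le> t" "t \<le> 1 / 6"
  shows "- t - ln (1 - t) \<le> 13 / 10 * omega t"
proof -
  \<comment> \<open>The Taylor coefficient 1/3 is raised to 2/5 to cover the tail of the series; the
    resulting derivative stays nonnegative exactly up to \<open>x = 1 / 6\<close>.\<close>
  have "0 \<le> (t\<^sup>2 / 2 + 2 / 5 * t ^ 3) - (- t - ln (1 - t))"
  proof (rule nonneg_if_deriv_nonneg[OF t(1), where h' = "\<lambda>x. x\<^sup>2 * (1 / 5 - 6 / 5 * x) / (1 - x)"])
    fix x :: real assume x: "0 \<le> x" "x \<le> t"
    then show "((\<lambda>t. (t\<^sup>2 / 2 + 2 / 5 * t ^ 3) - (- t - ln (1 - t))) has_real_derivative
        x\<^sup>2 * (1 / 5 - 6 / 5 * x) / (1 - x)) (at x)"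
      using t by (auto intro!: derivative_eq_intros simp: divide_simps) (simp add: algebra_simps power2_eq_square power3_eq_cube)
    show "0 \<le> x\<^sup>2 * (1 / 5 - 6 / 5 * x) / (1 - x)" using x t by simp
  qed simp
  moreover have "0 \<le> (t - ln (1 + t)) - (t\<^sup>2 / 2 - t ^ 3 / 3)"
  proof (rule nonneg_if_deriv_nonneg[OF t(1), where h' = "\<lambda>x. x ^ 3 / (1 + x)"])
    fix x :: real assume x: "0 \<le> x" "x \<le> t"
    then show "((\<lambda>t. (t - ln (1 + t)) - (t\<^sup>2 / 2 - t ^ 3 / 3)) has_real_derivative x ^ 3 / (1 + x)) (at x)"
      by (auto intro!: derivative_eq_intros simp: divide_simps) (simp add: algebra_simps power2_eq_square power3_eq_cube)
    show "0 \<le> x ^ 3 / (1 + x)" using x by simp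
  qed simp
  \<comment> \<open>This is 13/10 times the lower Taylor bound minus the upper one; it is
    nonnegative since \<open>5 / 6 * t\<close> is at most 5/36, below 3/20.\<close>
  moreover have "0 \<le> t\<^sup>2 * (3 / 20 - 5 / 6 * t)" using t by simp
  then have "t\<^sup>2 / 2 + 2 / 5 * t ^ 3 \<le> 13 / 10 * (t\<^sup>2 / 2 - t ^ 3 / 3)"
    by (simp add: algebra_simps power2_eq_square power3_eq_cube)
  ultimately show ?thesis unfolding omega_def by argo
qed

section \<open>One step of the damped Newton method\<close>

lemma
  fixes f :: "real ^ 'n \<Rightarrow> real" and y p :: "real ^ 'n"
  assumes sc: "standard_self_concordant f" and pd: "\<And>w u. u \<noteq> 0 \<Longrightarrow> 0 < u \<bullet> (hessian f w *v u)"
  defines "r \<equiv> sqrt (p \<bullet> (hessian f y *v p))"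
  shows self_concordant_ge: "f (y + p) \<ge> f y + gradient f y \<bullet> p + r - ln (1 + r)"
    and self_concordant_le: "r < 1 \<Longrightarrow> f (y + p) \<le> f y + gradient f y \<bullet> p - r - ln (1 - r)"
proof -
  have C: "continuous_third_derivs f"
    and c: "\<And>s. \<bar>p \<bullet> (third_deriv f (y + s *\<^sub>R p) p *v p)\<bar>
      \<le> 2 * (p \<bullet> (hessian f (y + s *\<^sub>R p) *v p)) powr (3 / 2)"
    using sc by (auto simp: standard_self_concordant_def)
  note line = DERIV_line[OF C, of y p] DERIV_line2[OF C, of y p] DERIV_line3[OF C, of p y]
  show "f (y + p) \<ge> f y + gradient f y \<bullet> p + r - ln (1 + r)"
  \<comment> \<open>The scalar lemmas need a strictly positive second derivative along the line,
    which fails for \<open>p = 0\<close>, where the bound is trivial.\<close>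
  proof (cases "p = 0")
    case False
    then show ?thesis
      using self_concordant_line_ge[OF line pd c] by (simp add: r_def)
  qed (simp add: r_def)
  assume "r < 1"
  then show "f (y + p) \<le> f y + gradient f y \<bullet> p - r - ln (1 - r)"
  proof (cases "p = 0")
    case False
    then show ?thesis
      using self_concordant_line_le[OF line pd c] \<open>r < 1\<close> by (simp add: r_def)
  qed (simp add: r_def)
qed

section \<open>Local coordinates given by the square root of the Hessian\<close>

locale strongly_convex_self_concordant =
  fixes f :: "real ^ 'n \<Rightarrow> real" and lam L :: real
  assumes sc: "standard_self_concordant f"
    and lam: "0 < lam" "lam \<le> L"
    and lower: "\<And>x. mat lam \<preceq> hessian f x" and upper: "\<And>x. hessian f x \<preceq> mat L"
begin

abbreviation "S x \<equiv> matrix_sqrt (hessian f x)"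
abbreviation "U x \<equiv> matrix_inv_sqrt (hessian f x) *v gradient f x"

lemmas root = matrix_sqrt[OF lower upper lam]

lemma hessian_pos: "u \<noteq> 0 \<Longrightarrow> 0 < u \<bullet> (hessian f w *v u)"
  using root(4)[of u w] lam by (smt (verit) inner_gt_zero_iff mult_pos_pos)

lemma local_norm: "sqrt (p \<bullet> (hessian f y *v p)) = norm (S y *v p)"
  by (simp add: norm_eq_sqrt_inner pos_semidef_square_inner[OF root(1,2)])

lemma sqrt_symmetric: "(S y *v x) \<bullet> z = x \<bullet> (S y *v z)"
  using root(1)[of y] by (simp add: pos_semidef_def symmetric_inner_matrix)

text \<open>In the coordinates \<open>S y *v p\<close> the gradient is represented by
  \<open>U y\<close>, so Cauchy-Schwarz compares the linear term with the local norm of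
  \<open>p\<close>.\<close>

lemma gradient_inner: "gradient f y \<bullet> p = U y \<bullet> (S y *v p)"
  by (metis root(3) sqrt_symmetric)

lemma sqrt_norm_bounds: "sqrt lam * norm x \<le> norm (S y *v x)" "norm (S y *v x) \<le> sqrt L * norm x"
  using root(4)[of x y] root(5)[of x y] lam
  by (simp_all add: norm_eq_sqrt_inner pos_semidef_square_inner[OF root(1,2)] flip: real_sqrt_mult)

text \<open>The damping gives the step local norm \<open>d / (1 + d) < 1\<close>, so the logarithmic
  upper bound applies, and \<open>- ln (1 - d / (1 + d))\<close> equals \<open>ln (1 + d)\<close>.
  Inexactness enters only through the linear term, via Cauchy-Schwarz.\<close>

lemma inexact_step_decrease:
  assumes "d = norm (S y *v v)"
  shows "f (y - (1 / (1 + d)) *\<^sub>R v) \<le> f y - omega d + norm (U y - S y *v v) * d / (1 + d)"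
proof -
  have d: "0 \<le> d" using assms by simp
  define p where "p = - ((1 / (1 + d)) *\<^sub>R v)"
  have Sp: "S y *v p = - ((1 / (1 + d)) *\<^sub>R (S y *v v))"
    by (metis p_def matrix_vector_mult_scaleR scaleR_minus_left)
  have np: "norm (S y *v p) = d / (1 + d)"
    using d by (simp add: Sp assms[symmetric])
  \<comment> \<open>\<open>U y\<close> is split into \<open>S y *v v\<close>, its value for an exact
    step, and the residual.\<close>
  have "U y \<bullet> (S y *v v) = d\<^sup>2 - (S y *v v - U y) \<bullet> (S y *v v)"
    by (simp add: assms power2_norm_eq_inner inner_diff_left)
  moreover have "(S y *v v - U y) \<bullet> (S y *v v) \<le> norm (U y - S y *v v) * d"
    by (metis assms norm_cauchy_schwarz norm_minus_commute)
  ultimately have ip: "d\<^sup>2 - norm (U y - S y *v v) * d \<le> U y \<bullet> (S y *v v)" by simp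
  have "f (y + p) \<le> f y + gradient f y \<bullet> p - d / (1 + d) - ln (1 - d / (1 + d))"
    using self_concordant_le[OF sc hessian_pos, of p y] d by (simp add: local_norm np)
  also have "ln (1 - d / (1 + d)) = - ln (1 + d)"
    using d by (simp add: field_simps flip: ln_inverse)
  also have "gradient f y \<bullet> p = - (U y \<bullet> (S y *v v)) / (1 + d)"
    by (simp add: gradient_inner Sp)
  also have "f y + - (U y \<bullet> (S y *v v)) / (1 + d) - d / (1 + d) - - ln (1 + d)
      \<le> f y + - (d\<^sup>2 - norm (U y - S y *v v) * d) / (1 + d) - d / (1 + d) - - ln (1 + d)"
    using ip d by (intro add_left_mono diff_right_mono divide_right_mono) auto
  also have "\<dots> = f y - omega d + norm (U y - S y *v v) * d / (1 + d)"
  proof -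
    have "d\<^sup>2 / (1 + d) = d - d / (1 + d)" using d by (simp add: field_simps power2_eq_square)
    then show ?thesis by (simp add: omega_def diff_divide_distrib)
  qed
  finally show ?thesis by (simp add: p_def)
qed

text \<open>For the exact Newton direction the residual vanishes and \<open>d\<close> is the norm of
  \<open>U y\<close>.\<close>

lemma exact_step_decrease: "\<exists>z. f z \<le> f y - omega (norm (U y))"
proof -
  have "S y *v (matrix_inv_sqrt (hessian f y) *v U y) = U y" by (rule root(3))
  then show ?thesis
    using inexact_step_decrease[OF refl, of y "matrix_inv_sqrt (hessian f y) *v U y"] by auto
qed

text \<open>The linear term is at least \<open>- t * r\<close>, and Young's inequality for
  \<open>omega\<close> and its conjugate removes the dependence on the distance
  \<open>r\<close>.\<close>

lemma global_lower_bound: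
  assumes t: "norm (U y) < 1"
  shows "f z \<ge> f y + norm (U y) + ln (1 - norm (U y))"
proof -
  define t where "t = norm (U y)"
  define p where "p = z - y"
  define r where "r = norm (S y *v p)"
  have tr: "0 \<le> t" "t < 1" "0 \<le> r" using assms by (auto simp: t_def r_def)
  have "f z \<ge> f y + gradient f y \<bullet> p + r - ln (1 + r)"
    using self_concordant_ge[OF sc hessian_pos, of y p] by (simp add: local_norm p_def r_def)
  moreover have "\<bar>gradient f y \<bullet> p\<bar> \<le> t * r"
    unfolding gradient_inner t_def r_def by (rule Cauchy_Schwarz_ineq2)
  \<comment> \<open>Young's inequality in disguise: \<open>ln x \<le> x - 1\<close> at
    \<open>x = (1 + r) * (1 - t)\<close>.\<close>
  moreover have "ln ((1 + r) * (1 - t)) \<le> (1 + r) * (1 - t) - 1"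
    using tr by (intro ln_le_minus_one) (simp add: add_pos_nonneg)
  then have "ln (1 + r) + ln (1 - t) \<le> r - t - t * r"
    using tr by (subst (asm) ln_mult_pos) (auto simp: algebra_simps)
  ultimately show ?thesis by (simp add: t_def[symmetric])
qed

text \<open>\<open>S y\<close> maps the residual in local coordinates to the Euclidean one. Passing
  back costs \<open>1 / sqrt lam\<close>, bounding the gradient by \<open>U y\<close> costs
  \<open>sqrt L\<close>, and the factor \<open>(lam / L) powr (1 / 2)\<close> in the tolerance
  cancels both.\<close>

lemma relative_residual:
  assumes "norm (hessian f y *v v - gradient f y) \<le> b * (lam / L) powr (1 / 2) * norm (gradient f y)"
    and b: "0 \<le> b"
  shows "norm (U y - S y *v v) \<le> b * norm (U y)"
proof -
  have L: "L > 0" using lam by simp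
  have "S y *v (U y - S y *v v) = gradient f y - hessian f y *v v"
    by (simp only: matrix_vector_mult_diff_distrib root(3))
      (simp only: matrix_vector_mul_assoc root(2))
  then have "sqrt lam * norm (U y - S y *v v) \<le> norm (hessian f y *v v - gradient f y)"
    using sqrt_norm_bounds(1) by (metis norm_minus_commute)
  also have "\<dots> \<le> b * (lam / L) powr (1 / 2) * norm (gradient f y)" by fact
  also have "norm (gradient f y) = norm (S y *v U y)" by (simp add: root(3))
  also have "b * (lam / L) powr (1 / 2) * norm (S y *v U y)
      \<le> b * (lam / L) powr (1 / 2) * (sqrt L * norm (U y))"
    using b by (intro mult_left_mono sqrt_norm_bounds(2)) auto
  also have "\<dots> = sqrt lam * (b * norm (U y))"
    using lam L by (simp add: powr_half_sqrt real_sqrt_divide)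
  finally show ?thesis using lam by (simp add: mult_le_cancel_left_pos)
qed

text \<open>The triangle inequality gives \<open>(1 - b) * norm (U y) \<le> d\<close>. Hence the
  error term is at most a multiple of \<open>d\<^sup>2 / (1 + d)\<close>, controlled by
  \<open>omega_ge\<close>, and \<open>omega d\<close> is comparable with
  \<open>omega (norm (U y))\<close> by \<open>omega_scale_ge\<close>.\<close>

lemma relative_step_decrease:
  assumes res: "norm (U y - S y *v v) \<le> b * norm (U y)" and b: "0 \<le> b" "b < 1"
    and d: "d = norm (S y *v v)"
  shows "f (y - (1 / (1 + d)) *\<^sub>R v) \<le> f y - (1 - 2 * b / (1 - b)) * omega d"
    and "(1 - b)\<^sup>2 * omega (norm (U y)) \<le> omega d"
proof -
  have d0: "0 \<le> d" using d by simp
  have t: "(1 - b) * norm (U y) \<le> d"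
    using norm_triangle_sub[of "U y" "S y *v v"] res d by (simp add: algebra_simps)
  then have "norm (U y) \<le> d / (1 - b)" using b by (simp add: field_simps)
  with res b have "norm (U y - S y *v v) \<le> b * (d / (1 - b))"
    by (meson mult_left_mono order_trans)
  then have "norm (U y - S y *v v) * (d / (1 + d)) \<le> (b * (d / (1 - b))) * (d / (1 + d))"
    using d0 by (intro mult_right_mono) auto
  also have "\<dots> = 2 * b / (1 - b) * (d\<^sup>2 / (2 * (1 + d)))"
    using d0 b by (simp add: divide_simps power2_eq_square)
  also have "\<dots> \<le> 2 * b / (1 - b) * omega d"
    using b d0 by (intro mult_left_mono omega_ge) auto
  finally show "f (y - (1 / (1 + d)) *\<^sub>R v) \<le> f y - (1 - 2 * b / (1 - b)) * omega d"
    using inexact_step_decrease[OF d] by (simp add: algebra_simps)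
  have "(1 - b)\<^sup>2 * omega (norm (U y)) \<le> omega ((1 - b) * norm (U y))"
    using b by (intro omega_scale_ge) auto
  also have "\<dots> \<le> omega d" using b t by (intro omega_mono) auto
  finally show "(1 - b)\<^sup>2 * omega (norm (U y)) \<le> omega d" .
qed

end

theorem theorem1:
  fixes f :: "real ^ 'n \<Rightarrow> real"
    and w :: "nat \<Rightarrow> real ^ 'n"
    and \<epsilon> :: "nat \<Rightarrow> real"
    and u :: "nat \<Rightarrow> real ^ 'n"
    and L lam \<beta> :: real
  assumes "standard_self_concordant f"
    and "L \<ge> lam" and "lam > 0"
    and "\<And>x. mat lam \<preceq> hessian f x"
    and "\<And>x. hessian f x \<preceq> mat L"
    and "\<beta> = 1 / 20"
    and "\<And>k. \<epsilon> k = \<beta> * (lam / L) powr (1 / 2) * norm (gradient f (w k))"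
    and "inexact_damped_newton f \<epsilon> w"
    and "\<And>k. u k = matrix_inv_sqrt (hessian f (w k)) *v gradient f (w k)"
  shows "(\<forall>k. f (w (Suc k)) \<le> f (w k) - 1 / 2 * omega (norm (u k))) \<and>
    (\<forall>k. norm (u k) \<le> 1 / 6 \<longrightarrow> omega (norm (u (Suc k))) \<le> 1 / 2 * omega (norm (u k)))"
proof -
  interpret strongly_convex_self_concordant f lam L
    using assms(1-5) by unfold_locales auto
  note uk = assms(9)
  \<comment> \<open>For \<open>b = 1 / 20\<close> the two factors are
    \<open>1 - 2 * b / (1 - b) = 17 / 19\<close> and \<open>(1 - b)\<^sup>2 = 361 / 400\<close>;
    their product is 323/400.\<close>
  have dec: "f (w (Suc k)) \<le> f (w k) - 323 / 400 * omega (norm (u k))" for k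
  proof -
    obtain v where v: "norm (hessian f (w k) *v v - gradient f (w k)) \<le> \<epsilon> k"
      "w (Suc k) = w k - (1 / (1 + norm (S (w k) *v v))) *\<^sub>R v"
      using assms(8) unfolding inexact_damped_newton_def Let_def local_norm by blast
    have "norm (U (w k) - S (w k) *v v) \<le> 1 / 20 * norm (U (w k))"
      using v(1) by (intro relative_residual) (simp_all add: assms(6,7))
    from relative_step_decrease[OF this _ _ refl] v(2) show ?thesis
      by (simp add: uk power2_eq_square)
  qed
  have "f (w (Suc k)) \<le> f (w k) - 1 / 2 * omega (norm (u k))" for k
    using dec[of k] omega_nonneg[of "norm (u k)"] by simp
  moreover have "omega (norm (u (Suc k))) \<le> 1 / 2 * omega (norm (u k))" if k: "norm (u k) \<le> 1 / 6" for k
  proof -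
    \<comment> \<open>\<open>z\<close> is a hypothetical exact step from \<open>w (Suc k)\<close>,
      not an iterate.\<close>
    obtain z where z: "f z \<le> f (w (Suc k)) - omega (norm (u (Suc k)))"
      using exact_step_decrease uk by metis
    have "f z \<ge> f (w k) + norm (u k) + ln (1 - norm (u k))"
      using global_lower_bound[of "w k" z] k by (simp add: uk)
    \<comment> \<open>The remaining factor is 13/10 - 323/400 = 197/400, just below 1/2.\<close>
    with z dec[of k] omega_conjugate_le[of "norm (u k)"] k omega_nonneg[of "norm (u k)"]
    show ?thesis by simp
  qed
  ultimately show ?thesis by blast
qed

end
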